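(* Suppose $\max\left\{\frac{|\delta+\mu|}{1+\beta},\frac{|\delta-\mu|}{1-\beta}\right\}\rho(G)<1$, $\mu<\beta\delta$, and $x^{A0}>\mathbf 0$, $x^{B0}>\mathbf 0$. Then, for any two candidate pricing policies $p^{A(1)},p^{A(2)}\in\mathbb R^n$ that satisfy $p^{A0}\le p^{A(2)}\le p^{A(1)}\le p^{\lim}$, if $$Q(p^{A(1)}+p^{A(2)})\ge v,\tag{C1}$$ then $\phi(p^{A(1)})\ge\phi(p^{A(2)})$, i.e. $p^{A(1)}$ achieves higher welfare than $p^{A(2)}$. On the other hand, if $$Q(p^{A(1)}+p^{A(2)})<v,\tag{C2}$$ then $\phi(p^{A(1)})<\phi(p^{A(2)})$. In particular, if (C1) holds with $p^{A(1)}=p^{\max}\le p^{\lim}$ and $p^{A(2)}=p^{A0}$, then $p^{\max}$ is an optimal solution of $\boldsymbol P$, and under this policy the aggregate unsustainable effort $\sum_ix_i^{B*}$ is minimal (over all feasible policies) in the post-intervention equilibrium. On the other hand, if (C2) holds with $p^{A(1)}=p^{\max}$ and $p^{A(2)}=p^{A0}$ and the policy $p^{A0}$ satisfies the tolerance constraint $b_\Delta^\top p^{A0}\ge k_0$ on aggregate unsustainable effort, then $p^{A0}$ is an optimal solution of $\boldsymbol P$, and under this policy the aggregate unsustainable effort is maximal (over all feasible policies) in the post-intervention equilibrium.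
   Context: $G\in\{0,1\}^{n\times n}$ is the symmetric, zero-diagonal adjacency matrix of an undirected graph on $n$ agents; $\rho(G)$ is its spectral radius; $\beta\in(0,1)$, $\delta>0$, $\mu>0$. Inequalities are entrywise; $\mathbf 1$ is the all-ones vector. Let $$M^+:=((1+\beta)I-(\delta+\mu)G)^{-1},\quad M^-:=((1-\beta)I-(\delta-\mu)G)^{-1},\quad M_\Delta:=M^--M^+,$$ $$Q:=(1+\beta)(M^+)^2+(1-\beta)(M^-)^2,\quad R:=(1-\beta)(M^-)^2-(1+\beta)(M^+)^2,\quad v:=2Rp^{B0},$$ where $p^{A0},p^{B0}\in\mathbb R^n_{\ge0}$ are pre-intervention prices of sustainable and unsustainable goods. For a policy $p^A$ (with $p^B=p^{B0}$ fixed) the equilibrium efforts are $x^{A*}=\frac12((M^++M^-)p^A+(M^+-M^-)p^{B0})$, $x^{B*}=\frac12((M^+-M^-)p^A+(M^++M^-)p^{B0})$, and $(x^{A0},x^{B0})$ denotes their values at $p^A=p^{A0}$. The equilibrium welfare is $$\phi(p^A)=\tfrac14\big((p^A)^\top Qp^A-v^\top p^A+(p^{B0})^\top Qp^{B0}\big).$$ Let $p^{\lim}:=M_\Delta^{-1}(M^++M^-)p^{B0}$ ($M_\Delta$ is invertible under the stated hypotheses), $b_\Delta:=M_\Delta\mathbf 1$, $k_0:=\mathbf 1^\top(M^++M^-)^\top p^{B0}-2\tau^B$, where $\tau^B\ge0$ is a tolerance on aggregate unsustainable effort. Problem $\boldsymbol P$: maximize $\phi(p^A)$ over $p^A$ subject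 to $b_\Delta^\top p^A\ge k_0$ (equivalently $\sum_ix_i^{B*}\le\tau^B$) and $p^{A0}\le p^A\le p^{\max}$. The upper bound $p^{\max}\ge p^{A0}$ satisfies $b_\Delta^\top p^{\max}\ge k_0$, so that $\boldsymbol P$ is feasible.
   Formalization: In the (C2) comparison the two policies are assumed distinct, since for equal policies (C2) can hold (e.g. a regular graph with constant prices) while the strict inequality in welfare cannot. *)

theory Defs
  imports "Jordan_Normal_Form.Spectral_Radius" "Jordan_Normal_Form.Gauss_Jordan_Elimination"
begin

text \<open>The order \<open>\<le>\<close> on vectors from \<open>Jordan_Normal_Form.Matrix\<close> is the entrywise one, but the
  strict order that comes with it is not the entrywise strict order; hence the following.\<close>

definition vec_lt :: "real vec \<Rightarrow> real vec \<Rightarrow> bool" where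
  "vec_lt v w \<longleftrightarrow> dim_vec v = dim_vec w \<and> (\<forall>i < dim_vec w. v $ i < w $ i)"

definition ones :: "nat \<Rightarrow> real vec" where
  "ones n = vec n (\<lambda>_. 1)"

text \<open>Unspecified for singular matrices. Every matrix it is applied to below is invertible when
  \<open>0 < \<beta> < 1\<close>, \<open>0 < \<mu> < \<beta> * \<delta>\<close> and both \<open>(\<delta> + \<mu>) * rho G < 1 + \<beta>\<close>,
  \<open>(\<delta> - \<mu>) * rho G < 1 - \<beta>\<close> hold for the symmetric matrix \<open>G\<close>.\<close>

definition minv :: "real mat \<Rightarrow> real mat" where
  "minv A = the (mat_inverse A)"

definition adjacency_matrix :: "nat \<Rightarrow> real mat \<Rightarrow> bool" where
  "adjacency_matrix n G \<longleftrightarrow> G \<in> carrier_mat n n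
     \<and> (\<forall>i < n. \<forall>j < n. G $$ (i, j) \<in> {0, 1})
     \<and> (\<forall>i < n. \<forall>j < n. G $$ (i, j) = G $$ (j, i))
     \<and> (\<forall>i < n. G $$ (i, i) = 0)"

text \<open>The spectral radius of a real matrix ranges over its complex eigenvalues.\<close>

definition rho :: "real mat \<Rightarrow> real" where
  "rho G = spectral_radius (map_mat complex_of_real G)"

definition M_plus :: "real mat \<Rightarrow> real \<Rightarrow> real \<Rightarrow> real \<Rightarrow> real mat" where
  "M_plus G \<beta> \<delta> \<mu> = minv ((1 + \<beta>) \<cdot>\<^sub>m 1\<^sub>m (dim_row G) - (\<delta> + \<mu>) \<cdot>\<^sub>m G)"

definition M_minus :: "real mat \<Rightarrow> real \<Rightarrow> real \<Rightarrow> real \<Rightarrow> real mat" where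
  "M_minus G \<beta> \<delta> \<mu> = minv ((1 - \<beta>) \<cdot>\<^sub>m 1\<^sub>m (dim_row G) - (\<delta> - \<mu>) \<cdot>\<^sub>m G)"

definition M_diff :: "real mat \<Rightarrow> real \<Rightarrow> real \<Rightarrow> real \<Rightarrow> real mat" where
  "M_diff G \<beta> \<delta> \<mu> = M_minus G \<beta> \<delta> \<mu> - M_plus G \<beta> \<delta> \<mu>"

definition M_sum :: "real mat \<Rightarrow> real \<Rightarrow> real \<Rightarrow> real \<Rightarrow> real mat" where
  "M_sum G \<beta> \<delta> \<mu> = M_plus G \<beta> \<delta> \<mu> + M_minus G \<beta> \<delta> \<mu>"

definition Q_mat :: "real mat \<Rightarrow> real \<Rightarrow> real \<Rightarrow> real \<Rightarrow> real mat" where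
  "Q_mat G \<beta> \<delta> \<mu> = (1 + \<beta>) \<cdot>\<^sub>m (M_plus G \<beta> \<delta> \<mu> ^\<^sub>m 2) + (1 - \<beta>) \<cdot>\<^sub>m (M_minus G \<beta> \<delta> \<mu> ^\<^sub>m 2)"

definition R_mat :: "real mat \<Rightarrow> real \<Rightarrow> real \<Rightarrow> real \<Rightarrow> real mat" where
  "R_mat G \<beta> \<delta> \<mu> = (1 - \<beta>) \<cdot>\<^sub>m (M_minus G \<beta> \<delta> \<mu> ^\<^sub>m 2) - (1 + \<beta>) \<cdot>\<^sub>m (M_plus G \<beta> \<delta> \<mu> ^\<^sub>m 2)"

definition v_vec :: "real mat \<Rightarrow> real \<Rightarrow> real \<Rightarrow> real \<Rightarrow> real vec \<Rightarrow> real vec" where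
  "v_vec G \<beta> \<delta> \<mu> pB0 = 2 \<cdot>\<^sub>v (R_mat G \<beta> \<delta> \<mu> *\<^sub>v pB0)"

text \<open>Equilibrium efforts under the policy \<open>pA\<close>, with the other price fixed at \<open>pB0\<close>.\<close>

definition effort_A :: "real mat \<Rightarrow> real \<Rightarrow> real \<Rightarrow> real \<Rightarrow> real vec \<Rightarrow> real vec \<Rightarrow> real vec" where
  "effort_A G \<beta> \<delta> \<mu> pB0 pA =
     (1/2) \<cdot>\<^sub>v ((M_plus G \<beta> \<delta> \<mu> + M_minus G \<beta> \<delta> \<mu>) *\<^sub>v pA + (M_plus G \<beta> \<delta> \<mu> - M_minus G \<beta> \<delta> \<mu>) *\<^sub>v pB0)"

definition effort_B :: "real mat \<Rightarrow> real \<Rightarrow> real \<Rightarrow> real \<Rightarrow> real vec \<Rightarrow> real vec \<Rightarrow> real vec" where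
  "effort_B G \<beta> \<delta> \<mu> pB0 pA =
     (1/2) \<cdot>\<^sub>v ((M_plus G \<beta> \<delta> \<mu> - M_minus G \<beta> \<delta> \<mu>) *\<^sub>v pA + (M_plus G \<beta> \<delta> \<mu> + M_minus G \<beta> \<delta> \<mu>) *\<^sub>v pB0)"

definition aggregate_B :: "real mat \<Rightarrow> real \<Rightarrow> real \<Rightarrow> real \<Rightarrow> real vec \<Rightarrow> real vec \<Rightarrow> real" where
  "aggregate_B G \<beta> \<delta> \<mu> pB0 pA = (\<Sum>i < dim_row G. effort_B G \<beta> \<delta> \<mu> pB0 pA $ i)"

definition welfare :: "real mat \<Rightarrow> real \<Rightarrow> real \<Rightarrow> real \<Rightarrow> real vec \<Rightarrow> real vec \<Rightarrow> real" where
  "welfare G \<beta> \<delta> \<mu> pB0 pA =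
     (1/4) * (pA \<bullet> (Q_mat G \<beta> \<delta> \<mu> *\<^sub>v pA) - v_vec G \<beta> \<delta> \<mu> pB0 \<bullet> pA + pB0 \<bullet> (Q_mat G \<beta> \<delta> \<mu> *\<^sub>v pB0))"

definition p_lim :: "real mat \<Rightarrow> real \<Rightarrow> real \<Rightarrow> real \<Rightarrow> real vec \<Rightarrow> real vec" where
  "p_lim G \<beta> \<delta> \<mu> pB0 = (minv (M_diff G \<beta> \<delta> \<mu>) * M_sum G \<beta> \<delta> \<mu>) *\<^sub>v pB0"

definition b_diff :: "real mat \<Rightarrow> real \<Rightarrow> real \<Rightarrow> real \<Rightarrow> real vec" where
  "b_diff G \<beta> \<delta> \<mu> = M_diff G \<beta> \<delta> \<mu> *\<^sub>v ones (dim_row G)"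

definition k0 :: "real mat \<Rightarrow> real \<Rightarrow> real \<Rightarrow> real \<Rightarrow> real vec \<Rightarrow> real \<Rightarrow> real" where
  "k0 G \<beta> \<delta> \<mu> pB0 \<tau>B = ones (dim_row G) \<bullet> (transpose_mat (M_sum G \<beta> \<delta> \<mu>) *\<^sub>v pB0) - 2 * \<tau>B"

definition feasible ::
  "real mat \<Rightarrow> real \<Rightarrow> real \<Rightarrow> real \<Rightarrow> real vec \<Rightarrow> real vec \<Rightarrow> real \<Rightarrow> real vec \<Rightarrow> real vec set" where
  "feasible G \<beta> \<delta> \<mu> pA0 pB0 \<tau>B pmax =
     {pA \<in> carrier_vec (dim_row G).
        b_diff G \<beta> \<delta> \<mu> \<bullet> pA \<ge> k0 G \<beta> \<delta> \<mu> pB0 \<tau>B \<and> pA0 \<le> pA \<and> pA \<le> pmax}"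

definition optimal ::
  "real mat \<Rightarrow> real \<Rightarrow> real \<Rightarrow> real \<Rightarrow> real vec \<Rightarrow> real vec \<Rightarrow> real \<Rightarrow> real vec \<Rightarrow> real vec \<Rightarrow> bool" where
  "optimal G \<beta> \<delta> \<mu> pA0 pB0 \<tau>B pmax p \<longleftrightarrow>
     p \<in> feasible G \<beta> \<delta> \<mu> pA0 pB0 \<tau>B pmax \<and>
     (\<forall>q \<in> feasible G \<beta> \<delta> \<mu> pA0 pB0 \<tau>B pmax. welfare G \<beta> \<delta> \<mu> pB0 q \<le> welfare G \<beta> \<delta> \<mu> pB0 p)"

definition C1 :: "real mat \<Rightarrow> real \<Rightarrow> real \<Rightarrow> real \<Rightarrow> real vec \<Rightarrow> real vec \<Rightarrow> real vec \<Rightarrow> bool" where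
  "C1 G \<beta> \<delta> \<mu> pB0 p1 p2 \<longleftrightarrow> Q_mat G \<beta> \<delta> \<mu> *\<^sub>v (p1 + p2) \<ge> v_vec G \<beta> \<delta> \<mu> pB0"

definition C2 :: "real mat \<Rightarrow> real \<Rightarrow> real \<Rightarrow> real \<Rightarrow> real vec \<Rightarrow> real vec \<Rightarrow> real vec \<Rightarrow> bool" where
  "C2 G \<beta> \<delta> \<mu> pB0 p1 p2 \<longleftrightarrow> vec_lt (Q_mat G \<beta> \<delta> \<mu> *\<^sub>v (p1 + p2)) (v_vec G \<beta> \<delta> \<mu> pB0)"

end

theory Submission
  imports Defs
begin

text \<open>Since \<open>Q\<close> is symmetric, the welfare is a quadratic polynomial whose difference factors exactly:
  \<open>4 (\<phi> p - \<phi> q) = (p - q) \<bullet> (Q (p + q) - v)\<close>. For \<open>q \<le> p\<close> the first factor is nonnegative, so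
  the sign of \<open>Q (p + q) - v\<close> decides which policy is better, which is exactly what (C1) and (C2)
  prescribe (\<open>welfare_diff\<close>, \<open>welfare_mono\<close>, \<open>welfare_strict_antimono\<close>).

  The statements on the optimization problem compare an extreme policy with every feasible one,
  although the condition is only imposed on the pair of extremes. They follow because \<open>Q\<close> is
  entrywise nonnegative: (C1) survives raising the smaller policy from \<open>pA0\<close> to a feasible one, and
  (C2) survives lowering the larger one from \<open>pmax\<close> (\<open>Q_sum_mono\<close>). The claims on the aggregate
  effort hold because \<open>M_diff\<close> is entrywise nonnegative, so that no agent's unsustainable effort
  grows when sustainable prices rise (\<open>aggregate_B_antimono\<close>).

  What remains is matrix theory: \<open>M_plus\<close> and \<open>M_minus\<close> are symmetric, nonnegative and ordered.
  Both have the form \<open>(a I - b G)\<inverse>\<close> with \<open>b \<rho>(G) < a\<close> and \<open>b \<ge> 0\<close>; the sign of \<open>\<delta> - \<mu>\<close> is where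
  \<open>\<mu> < \<beta> \<delta>\<close> enters first. Nonnegativity is the Neumann series argument, based on the fact that the
  powers of a matrix of spectral radius below one tend to zero (\<open>pow_mat_tendsto_zero\<close>,
  \<open>neumann_inverse_nonneg\<close>). The order comes from a resolvent identity and the inequality
  \<open>(\<delta> + \<mu>) / (1 + \<beta>) \<le> (\<delta> - \<mu>) / (1 - \<beta>)\<close>, a rewriting of \<open>\<mu> \<le> \<beta> \<delta>\<close> (\<open>resolvent_mono\<close>).\<close>

section \<open>Entrywise order\<close>

lemma mult_mat_nonneg:
  fixes A B :: "real mat"
  assumes "A \<in> carrier_mat m n" "B \<in> carrier_mat n k" "0\<^sub>m m n \<le> A" "0\<^sub>m n k \<le> B"
  shows "0\<^sub>m m k \<le> A * B"
  using assms
  by (auto simp: less_eq_mat_def scalar_prod_def intro!: sum_nonneg mult_nonneg_nonneg)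

lemma mult_mat_vec_mono:
  fixes A :: "real mat"
  assumes "A \<in> carrier_mat m n" "0\<^sub>m m n \<le> A" "x \<in> carrier_vec n" "y \<in> carrier_vec n" "x \<le> y"
  shows "A *\<^sub>v x \<le> A *\<^sub>v y"
  using assms
  by (auto simp: less_eq_mat_def less_eq_vec_def scalar_prod_def intro!: sum_mono mult_left_mono)

lemma smult_mat_mult_vec:
  fixes A :: "'a :: comm_semiring_0 mat"
  assumes "A \<in> carrier_mat m n" "x \<in> carrier_vec n"
  shows "(k \<cdot>\<^sub>m A) *\<^sub>v x = k \<cdot>\<^sub>v (A *\<^sub>v x)"
  by (rule eq_vecI) (use assms in auto)

section \<open>Matrices of spectral radius below one\<close>

lemma norm_eigenvalue_le_rho:
  assumes "A \<in> carrier_mat n n" "n > 0" "eigenvalue (map_mat complex_of_real A) e"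
  shows "norm e \<le> rho A"
  using spectral_radius_mem_max(2)[of "map_mat complex_of_real A" n "norm e"] assms
  by (auto simp: rho_def spectrum_def)

lemma rho_nonneg:
  assumes "A \<in> carrier_mat n n" "n > 0"
  shows "0 \<le> rho A"
  using spectral_radius_mem_max(1)[of "map_mat complex_of_real A" n] assms
  by (auto simp: rho_def)

text \<open>An eigenvector of \<open>s A\<close> for \<open>e\<close> is one of \<open>A\<close> for \<open>e / s\<close>. It is applied both
  to shrink \<open>G\<close> in the resolvents and to enlarge \<open>B\<close> slightly in \<open>pow_mat_tendsto_zero\<close>.\<close>

lemma rho_smult_le:
  assumes A: "A \<in> carrier_mat n n" and n: "n > 0" and s: "0 \<le> s"
  shows "rho (s \<cdot>\<^sub>m A) \<le> s * rho A"
proof -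
  let ?A = "map_mat complex_of_real A"
  let ?B = "map_mat complex_of_real (s \<cdot>\<^sub>m A)"
  have B: "?B = complex_of_real s \<cdot>\<^sub>m ?A" by (rule eq_matI) (use A in auto)
  have cA: "?A \<in> carrier_mat n n" and cB: "?B \<in> carrier_mat n n" using A by auto
  obtain e where e: "eigenvalue ?B e" and re: "rho (s \<cdot>\<^sub>m A) = norm e"
    using spectral_radius_mem_max(1)[OF cB n] unfolding rho_def spectrum_def by auto
  obtain v where v: "v \<in> carrier_vec n" "v \<noteq> 0\<^sub>v n" and "?B *\<^sub>v v = e \<cdot>\<^sub>v v"
    using e cB unfolding eigenvalue_def eigenvector_def by auto
  then have ev: "complex_of_real s \<cdot>\<^sub>v (?A *\<^sub>v v) = e \<cdot>\<^sub>v v"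
    unfolding B using cA v by (simp add: smult_mat_mult_vec[OF cA v(1)])
  show ?thesis
  proof (cases "s = 0")
    case True
    \<comment> \<open>The zero matrix has zero as its only eigenvalue: look at a nonzero entry of the eigenvector.\<close>
    have "e = 0"
    proof (rule ccontr)
      assume "e \<noteq> 0"
      moreover obtain i where "i < n" "v $ i \<noteq> 0" using v by (metis eq_vecI carrier_vecD index_zero_vec)
      moreover have "(complex_of_real s \<cdot>\<^sub>v (?A *\<^sub>v v)) $ i = (e \<cdot>\<^sub>v v) $ i" by (simp only: ev)
      ultimately show False using True v cA by auto
    qed
    then show ?thesis using re True by simp
  next
    case False
    have "?A *\<^sub>v v = (e / of_real s) \<cdot>\<^sub>v v"
    proof (rule eq_vecI)
      fix i assume i: "i < dim_vec ((e / of_real s) \<cdot>\<^sub>v v)"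
      have "(complex_of_real s \<cdot>\<^sub>v (?A *\<^sub>v v)) $ i = (e \<cdot>\<^sub>v v) $ i" by (simp only: ev)
      then have "complex_of_real s * ((?A *\<^sub>v v) $ i) = e * v $ i" using i v cA by auto
      then show "(?A *\<^sub>v v) $ i = ((e / of_real s) \<cdot>\<^sub>v v) $ i"
        using i v False by (simp add: field_simps)
    qed (use cA v in auto)
    then have "eigenvalue ?A (e / of_real s)"
      using v cA unfolding eigenvalue_def eigenvector_def by auto
    from norm_eigenvalue_le_rho[OF A n this] show ?thesis
      using False s re by (simp add: norm_divide field_simps)
  qed
qed

lemma pow_smult_mat:
  fixes A :: "real mat"
  assumes "A \<in> carrier_mat n n"
  shows "(r \<cdot>\<^sub>m A) ^\<^sub>m k = r ^ k \<cdot>\<^sub>m (A ^\<^sub>m k)"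
proof (induction k)
  case 0
  show ?case by (rule eq_matI) (use assms in auto)
next
  case (Suc k)
  have P: "A ^\<^sub>m k \<in> carrier_mat n n" using assms by simp
  have "(r \<cdot>\<^sub>m A) ^\<^sub>m Suc k = (r ^ k \<cdot>\<^sub>m (A ^\<^sub>m k)) * (r \<cdot>\<^sub>m A)" using Suc by simp
  also have "\<dots> = r ^ Suc k \<cdot>\<^sub>m (A ^\<^sub>m k * A)"
    by (rule eq_matI) (use assms P in auto)
  finally show ?case by simp
qed

text \<open>Via the Jordan normal form, spectral radius below one makes the powers bounded. Boundedness is
  turned into geometric decay by applying it to \<open>r B\<close> for some \<open>r > 1\<close> for which the spectral radius is
  still below one.\<close>

lemma pow_mat_tendsto_zero:
  assumes B: "B \<in> carrier_mat n n" and n: "n > 0" and r1: "rho B < 1" and ij: "i < n" "j < n"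
  shows "(\<lambda>k. (B ^\<^sub>m k) $$ (i, j)) \<longlonglongrightarrow> 0"
proof -
  \<comment> \<open>Any \<open>r\<close> strictly between \<open>1\<close> and \<open>1 / rho B\<close> would do; this one also works if \<open>rho B = 0\<close>.\<close>
  define r where "r = 2 / (1 + rho B)"
  have rho0: "0 \<le> rho B" by (rule rho_nonneg[OF B n])
  have r: "r > 1" "r * rho B < 1" using rho0 r1 by (auto simp: r_def field_simps)
  let ?C = "map_mat complex_of_real (r \<cdot>\<^sub>m B)"
  have C: "?C \<in> carrier_mat n n" using B by simp
  have "spectral_radius ?C < 1"
    using rho_smult_le[OF B n, of r] r by (simp add: rho_def)
  then obtain c where c: "\<And>k. norm_bound (?C ^\<^sub>m k) c"
    using spectral_radius_jnf_norm_bound_less_1_upper_triangular[OF C] by blast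
  have bound: "norm ((B ^\<^sub>m k) $$ (i, j)) \<le> c * (1 / r) ^ k" for k
  proof -
    have "?C ^\<^sub>m k = map_mat complex_of_real ((r \<cdot>\<^sub>m B) ^\<^sub>m k)"
      by (rule of_real_hom.mat_hom_pow[symmetric, of _ n]) (use B in simp)
    also have "\<dots> = map_mat complex_of_real (r ^ k \<cdot>\<^sub>m (B ^\<^sub>m k))"
      by (simp add: pow_smult_mat[OF B])
    finally have "norm (complex_of_real (r ^ k * (B ^\<^sub>m k) $$ (i, j))) \<le> c"
      using c[of k] ij B by (auto simp: norm_bound_def)
    then have "\<bar>r ^ k * (B ^\<^sub>m k) $$ (i, j)\<bar> \<le> c" by (simp only: norm_of_real real_norm_def)
    then show ?thesis using r by (simp add: abs_mult field_simps)
  qed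
  have "(\<lambda>k. (1 / r) ^ k) \<longlonglongrightarrow> 0" by (rule LIMSEQ_power_zero) (use r in auto)
  then have "(\<lambda>k. c * (1 / r) ^ k) \<longlonglongrightarrow> 0" by (rule tendsto_mult_right_zero)
  then show ?thesis by (rule tendsto_0_le[where K = 1, OF _ always_eventually])
      (use bound in \<open>auto intro: order_trans[OF _ abs_ge_self]\<close>)
qed

text \<open>The equation \<open>N = I + B N\<close> gives \<open>B\<^sup>k N - B\<^bsup>k+1\<^esup> N = B\<^sup>k \<ge> 0\<close>. So \<open>B\<^sup>k N\<close> decreases entrywise, from
  \<open>N\<close> at \<open>k = 0\<close> to the limit zero, and hence \<open>N \<ge> 0\<close>. This is the Neumann series \<open>N = \<Sum> B\<^sup>k\<close> with the
  partial sums hidden in the telescoping differences.\<close>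

lemma neumann_inverse_nonneg:
  fixes B N :: "real mat"
  assumes B: "B \<in> carrier_mat n n" and B0: "0\<^sub>m n n \<le> B" and n: "n > 0" and r1: "rho B < 1"
    and N: "N \<in> carrier_mat n n" and inv: "(1\<^sub>m n - B) * N = 1\<^sub>m n"
  shows "0\<^sub>m n n \<le> N"
proof -
  have "N - B * N = 1\<^sub>m n"
    using inv B N minus_mult_distrib_mat[of "1\<^sub>m n" n n B N n] by simp
  then have eq: "(N - B * N) $$ (i, j) = 1\<^sub>m n $$ (i, j)" for i j by (simp only:)
  have e: "N $$ (i, j) - (B * N) $$ (i, j) = 1\<^sub>m n $$ (i, j)" if "i < n" "j < n" for i j
    using eq[of i j] that B N by (simp del: index_mult_mat(1) index_one_mat(1))
  have BN: "B * N = N - 1\<^sub>m n"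
  proof (rule eq_matI)
    fix i j assume "i < dim_row (N - 1\<^sub>m n)" "j < dim_col (N - 1\<^sub>m n)"
    then show "(B * N) $$ (i, j) = (N - 1\<^sub>m n) $$ (i, j)" using e[of i j] by simp
  qed (use B N in auto)
  have Pk: "B ^\<^sub>m k \<in> carrier_mat n n" for k using B by simp
  have P0: "0\<^sub>m n n \<le> B ^\<^sub>m k" for k
  proof (induction k)
    case 0
    show ?case using B by (auto simp: less_eq_mat_def)
  next
    case (Suc k)
    show ?case using mult_mat_nonneg[OF Pk B Suc B0] by simp
  qed
  have step: "(B ^\<^sub>m Suc k * N) $$ (i, j) \<le> (B ^\<^sub>m k * N) $$ (i, j)" if ij: "i < n" "j < n" for i j k
  proof -
    have "B ^\<^sub>m Suc k * N = B ^\<^sub>m k * (B * N)"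
      using assoc_mult_mat[OF Pk B N] by simp
    also have "\<dots> = B ^\<^sub>m k * N - B ^\<^sub>m k"
      unfolding BN using Pk[of k] N mult_minus_distrib_mat[OF Pk[of k] N one_carrier_mat]
        right_mult_one_mat[OF Pk[of k]] by (simp only:)
    finally have "(B ^\<^sub>m Suc k * N) $$ (i, j) = (B ^\<^sub>m k * N) $$ (i, j) - (B ^\<^sub>m k) $$ (i, j)"
      using ij B N by simp
    moreover have "0 \<le> (B ^\<^sub>m k) $$ (i, j)" using P0[of k] ij Pk[of k] by (auto simp: less_eq_mat_def)
    ultimately show ?thesis by linarith
  qed
  have "0 \<le> N $$ (i, j)" if ij: "i < n" "j < n" for i j
  proof -
    have le: "(B ^\<^sub>m k * N) $$ (i, j) \<le> N $$ (i, j)" for k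
    proof (induction k)
      case 0
      show ?case using B N by simp
    next
      case (Suc k)
      show ?case using step[OF ij, of k] Suc by linarith
    qed
    have eq: "(B ^\<^sub>m k * N) $$ (i, j) = (\<Sum>l<n. (B ^\<^sub>m k) $$ (i, l) * N $$ (l, j))" for k
      using ij B N by (auto simp: scalar_prod_def atLeast0LessThan intro!: sum.cong)
    have "(\<lambda>k. \<Sum>l<n. (B ^\<^sub>m k) $$ (i, l) * N $$ (l, j)) \<longlonglongrightarrow> (\<Sum>l<n. 0)"
      by (intro tendsto_sum tendsto_mult_left_zero pow_mat_tendsto_zero[OF B n r1]) (use ij in auto)
    then have "(\<lambda>k. (B ^\<^sub>m k * N) $$ (i, j)) \<longlonglongrightarrow> 0" by (simp only: eq sum.neutral_const)
    then show ?thesis by (rule LIMSEQ_le_const2) (use le in blast)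
  qed
  then show ?thesis using N by (auto simp: less_eq_mat_def)
qed

section \<open>Resolvents of a nonnegative symmetric matrix\<close>

lemma minv_inverse:
  assumes A: "A \<in> carrier_mat n n" and d: "det A \<noteq> 0"
  shows "minv A \<in> carrier_mat n n" "A * minv A = 1\<^sub>m n" "minv A * A = 1\<^sub>m n"
proof -
  have "A \<in> Units (ring_mat TYPE(real) n ())" by (rule det_non_zero_imp_unit[OF A d])
  then obtain B where "mat_inverse A = Some B" using mat_inverse(1)[OF A] by fastforce
  then show "minv A \<in> carrier_mat n n" "A * minv A = 1\<^sub>m n" "minv A * A = 1\<^sub>m n"
    using mat_inverse(2)[OF A] by (auto simp: minv_def)
qed

context
  fixes n :: nat and G :: "real mat"
  assumes n: "n > 0" and G: "G \<in> carrier_mat n n" and G0: "0\<^sub>m n n \<le> G" and sym: "G\<^sup>T = G"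
begin

text \<open>If \<open>a I - b G\<close> were singular, \<open>a\<close> would be an eigenvalue of \<open>b G\<close>, contradicting \<open>b \<rho>(G) < a\<close>.\<close>

lemma det_resolvent_nonzero:
  assumes a: "0 < a" and b: "0 \<le> b" and ab: "b * rho G < a"
  shows "det (a \<cdot>\<^sub>m 1\<^sub>m n - b \<cdot>\<^sub>m G) \<noteq> 0"
proof
  let ?A = "a \<cdot>\<^sub>m 1\<^sub>m n - b \<cdot>\<^sub>m G"
  assume "det ?A = 0"
  then obtain v where v: "v \<in> carrier_vec n" "v \<noteq> 0\<^sub>v n" and "?A *\<^sub>v v = 0\<^sub>v n"
    using det_0_iff_vec_prod_zero[of ?A n] G by (metis minus_carrier_mat smult_carrier_mat)
  then have "(a \<cdot>\<^sub>m 1\<^sub>m n) *\<^sub>v v - (b \<cdot>\<^sub>m G) *\<^sub>v v = 0\<^sub>v n"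
    using G by (subst (asm) minus_mult_distrib_mat_vec) auto
  then have eq: "a \<cdot>\<^sub>v v - (b \<cdot>\<^sub>m G) *\<^sub>v v = 0\<^sub>v n"
    using v G by (simp add: smult_mat_mult_vec[of "1\<^sub>m n" n n])
  have cv: "(b \<cdot>\<^sub>m G) *\<^sub>v v = a \<cdot>\<^sub>v v"
  proof (rule eq_vecI)
    fix i assume "i < dim_vec (a \<cdot>\<^sub>v v)"
    moreover have "(a \<cdot>\<^sub>v v - (b \<cdot>\<^sub>m G) *\<^sub>v v) $ i = 0\<^sub>v n $ i" by (simp only: eq)
    ultimately show "((b \<cdot>\<^sub>m G) *\<^sub>v v) $ i = (a \<cdot>\<^sub>v v) $ i" using v G by simp
  qed (use v G in auto)
  have "eigenvalue (b \<cdot>\<^sub>m G) a"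
    using v G cv unfolding eigenvalue_def eigenvector_def by auto
  then have "eigenvalue (map_mat complex_of_real (b \<cdot>\<^sub>m G)) (of_real a)"
    by (intro of_real_hom.eigenvalue_hom[of _ n]) (use G in auto)
  then have "norm (complex_of_real a) \<le> rho (b \<cdot>\<^sub>m G)"
    by (intro norm_eigenvalue_le_rho[OF _ n]) (use G in auto)
  also have "\<dots> \<le> b * rho G" by (rule rho_smult_le[OF G n b])
  finally show False using a ab by simp
qed

lemmas minv_resolvent = minv_inverse[OF _ det_resolvent_nonzero]

lemma resolvent_nonneg:
  assumes a: "0 < a" and b: "0 \<le> b" and ab: "b * rho G < a"
  shows "0\<^sub>m n n \<le> minv (a \<cdot>\<^sub>m 1\<^sub>m n - b \<cdot>\<^sub>m G)"
proof -
  let ?A = "a \<cdot>\<^sub>m 1\<^sub>m n - b \<cdot>\<^sub>m G"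
  let ?B = "(b / a) \<cdot>\<^sub>m G"
  have A: "?A \<in> carrier_mat n n" using G by auto
  note M = minv_resolvent[OF A a b ab]
  have "rho ?B \<le> (b / a) * rho G" by (rule rho_smult_le[OF G n]) (use a b in auto)
  also have "\<dots> < 1" using a ab by (simp add: field_simps)
  finally have rB: "rho ?B < 1" .
  have "?A = a \<cdot>\<^sub>m (1\<^sub>m n - ?B)"
    by (rule eq_matI) (use a G in \<open>auto simp: field_simps\<close>)
  then have "a \<cdot>\<^sub>m (1\<^sub>m n - ?B) * minv ?A = 1\<^sub>m n" using M(2) by simp
  then have inv: "(1\<^sub>m n - ?B) * (a \<cdot>\<^sub>m minv ?A) = 1\<^sub>m n"
    using mult_smult_distrib[of "1\<^sub>m n - ?B" n n "minv ?A" n a]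
      mult_smult_assoc_mat[of "1\<^sub>m n - ?B" n n "minv ?A" n a] G M(1)
    by (simp add: minus_carrier_mat)
  have "0\<^sub>m n n \<le> a \<cdot>\<^sub>m minv ?A"
    by (rule neumann_inverse_nonneg[OF _ _ n rB _ inv])
      (use G G0 a b M(1) in \<open>auto simp: less_eq_mat_def\<close>)
  then show ?thesis using a M(1) by (auto simp: less_eq_mat_def zero_le_mult_iff)
qed

text \<open>The transpose of a right inverse of the symmetric matrix \<open>a I - b G\<close> is a left inverse of it, and
  left and right inverses agree.\<close>

lemma resolvent_symmetric:
  assumes a: "0 < a" and b: "0 \<le> b" and ab: "b * rho G < a"
  shows "(minv (a \<cdot>\<^sub>m 1\<^sub>m n - b \<cdot>\<^sub>m G))\<^sup>T = minv (a \<cdot>\<^sub>m 1\<^sub>m n - b \<cdot>\<^sub>m G)"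
proof -
  let ?A = "a \<cdot>\<^sub>m 1\<^sub>m n - b \<cdot>\<^sub>m G"
  let ?M = "minv ?A"
  have A: "?A \<in> carrier_mat n n" using G by auto
  note M = minv_resolvent[OF A a b ab]
  have "G $$ (j, i) = G $$ (i, j)" if "i < n" "j < n" for i j
    using that G sym by (metis carrier_matD index_transpose_mat(1))
  then have At: "?A\<^sup>T = ?A" by (intro eq_matI) (use G in auto)
  have "?M\<^sup>T * ?A = (?A * ?M)\<^sup>T" using transpose_mult[OF A M(1)] At by simp
  then have l: "?M\<^sup>T * ?A = 1\<^sub>m n" using M(2) by simp
  have Mt: "?M\<^sup>T \<in> carrier_mat n n" using M(1) by simp
  have "?M\<^sup>T = ?M\<^sup>T * (?A * ?M)" using M Mt by simp
  also have "\<dots> = (?M\<^sup>T * ?A) * ?M" using assoc_mult_mat[OF Mt A M(1)] by simp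
  also have "\<dots> = ?M" using l M(1) by simp
  finally show ?thesis .
qed

text \<open>With \<open>M\<^sub>i = (a\<^sub>i I - b\<^sub>i G)\<inverse>\<close>, inserting \<open>M\<^sub>i (a\<^sub>i I - b\<^sub>i G) = I\<close> on the appropriate side gives
  \<open>a\<^sub>2 M\<^sub>2 - a\<^sub>1 M\<^sub>1 = (a\<^sub>1 b\<^sub>2 - a\<^sub>2 b\<^sub>1) M\<^sub>2 G M\<^sub>1\<close>. The weights \<open>a\<^sub>i\<close> are chosen to cancel the multiples of the
  identity, whose sign would otherwise compete with that of the multiple of \<open>G\<close>. The right-hand side is
  nonnegative, and \<open>a\<^sub>2 \<le> a\<^sub>1\<close> then removes the weights: \<open>a\<^sub>2 M\<^sub>1 \<le> a\<^sub>1 M\<^sub>1 \<le> a\<^sub>2 M\<^sub>2\<close>.\<close>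

lemma resolvent_mono:
  assumes a1: "0 < a1" and b1: "0 \<le> b1" and ab1: "b1 * rho G < a1"
    and a2: "0 < a2" and b2: "0 \<le> b2" and ab2: "b2 * rho G < a2"
    and a: "a2 \<le> a1" and slope: "b1 / a1 \<le> b2 / a2"
  shows "minv (a1 \<cdot>\<^sub>m 1\<^sub>m n - b1 \<cdot>\<^sub>m G) \<le> minv (a2 \<cdot>\<^sub>m 1\<^sub>m n - b2 \<cdot>\<^sub>m G)"
proof -
  let ?A1 = "a1 \<cdot>\<^sub>m 1\<^sub>m n - b1 \<cdot>\<^sub>m G" and ?A2 = "a2 \<cdot>\<^sub>m 1\<^sub>m n - b2 \<cdot>\<^sub>m G"
  let ?M1 = "minv ?A1" and ?M2 = "minv ?A2"
  have A: "?A1 \<in> carrier_mat n n" "?A2 \<in> carrier_mat n n" using G by auto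
  note M1 = minv_resolvent[OF A(1) a1 b1 ab1] and M2 = minv_resolvent[OF A(2) a2 b2 ab2]
  note M10 = resolvent_nonneg[OF a1 b1 ab1] and M20 = resolvent_nonneg[OF a2 b2 ab2]
  let ?c = "a1 * b2 - a2 * b1"
  have c: "0 \<le> ?c" using slope a1 a2 by (simp add: field_simps)
  have "a2 \<cdot>\<^sub>m ?A1 - a1 \<cdot>\<^sub>m ?A2 = ?c \<cdot>\<^sub>m G"
    by (rule eq_matI) (use G in \<open>auto simp: algebra_simps\<close>)
  then have "?M2 * (?c \<cdot>\<^sub>m G) * ?M1 = ?M2 * (a2 \<cdot>\<^sub>m ?A1 - a1 \<cdot>\<^sub>m ?A2) * ?M1" by simp
  also have "\<dots> = a2 \<cdot>\<^sub>m (?M2 * ?A1 * ?M1) - a1 \<cdot>\<^sub>m (?M2 * ?A2 * ?M1)"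
    using A M1(1) M2(1)
    by (simp add: mult_minus_distrib_mat[of _ n n _ n] minus_mult_distrib_mat[of _ n n _ _ n]
        mult_smult_distrib[of _ n n _ n] mult_smult_assoc_mat[of _ n n _ n])
  also have "?M2 * ?A1 * ?M1 = ?M2 * (?A1 * ?M1)" by (rule assoc_mult_mat[OF M2(1) A(1) M1(1)])
  finally have eq: "a2 \<cdot>\<^sub>m ?M2 - a1 \<cdot>\<^sub>m ?M1 = ?M2 * (?c \<cdot>\<^sub>m G) * ?M1"
    using M1 M2 by simp
  have cG: "?c \<cdot>\<^sub>m G \<in> carrier_mat n n" "0\<^sub>m n n \<le> ?c \<cdot>\<^sub>m G"
    using G G0 c by (auto simp: less_eq_mat_def)
  have "0\<^sub>m n n \<le> ?M2 * (?c \<cdot>\<^sub>m G) * ?M1"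
    by (intro mult_mat_nonneg[of _ n n _ n] mult_carrier_mat[of _ n n]) (use cG M1(1) M2(1) M10 M20 in auto)
  then have d: "0\<^sub>m n n \<le> a2 \<cdot>\<^sub>m ?M2 - a1 \<cdot>\<^sub>m ?M1" by (simp only: eq)
  have "?M1 $$ (i, j) \<le> ?M2 $$ (i, j)" if ij: "i < n" "j < n" for i j
  proof -
    have "0 \<le> ?M1 $$ (i, j)" using M10 M1(1) ij by (auto simp: less_eq_mat_def)
    then have "a2 * ?M1 $$ (i, j) \<le> a1 * ?M1 $$ (i, j)" by (rule mult_right_mono[OF a])
    also have "\<dots> \<le> a2 * ?M2 $$ (i, j)" using d M1(1) M2(1) ij by (auto simp: less_eq_mat_def)
    finally show ?thesis using a2 by simp
  qed
  then show ?thesis using M1(1) M2(1) by (auto simp: less_eq_mat_def)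
qed

end

section \<open>Equilibrium and welfare\<close>

text \<open>The factorization \<open>x\<^sup>2 - y\<^sup>2 = (x - y) (x + y)\<close>; symmetry makes the mixed terms cancel.\<close>

lemma quadratic_form_diff:
  fixes A :: "real mat"
  assumes A: "A \<in> carrier_mat n n" "A\<^sup>T = A" and x: "x \<in> carrier_vec n" and y: "y \<in> carrier_vec n"
  shows "x \<bullet> (A *\<^sub>v x) - y \<bullet> (A *\<^sub>v y) = (x - y) \<bullet> (A *\<^sub>v (x + y))"
proof -
  have "y \<bullet> (A *\<^sub>v x) = (A\<^sup>T *\<^sub>v y) \<bullet> x"
    by (rule transpose_vec_mult_scalar[OF A(1) x y, symmetric])
  also have "\<dots> = x \<bullet> (A *\<^sub>v y)"
    unfolding A(2) by (rule comm_scalar_prod) (use A x y in auto)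
  finally have "y \<bullet> (A *\<^sub>v x) = x \<bullet> (A *\<^sub>v y)" .
  moreover have "A *\<^sub>v x \<in> carrier_vec n" "A *\<^sub>v y \<in> carrier_vec n" using A x y by auto
  ultimately show ?thesis
    using x y by (simp add: mult_add_distrib_mat_vec[OF A(1) x y] minus_scalar_prod_distrib[of _ n]
        scalar_prod_add_distrib[of _ n])
qed

text \<open>The hypothesis on the spectral radius is split into its two halves, without absolute values since
  both \<open>\<delta> + \<mu>\<close> and \<open>\<delta> - \<mu>\<close> are positive here.\<close>

locale coupled_markets =
  fixes n :: nat and G :: "real mat" and \<beta> \<delta> \<mu> :: real
  assumes n: "n > 0" and adj: "adjacency_matrix n G"
    and \<beta>: "0 < \<beta>" "\<beta> < 1" and \<delta>: "0 < \<delta>" and \<mu>: "0 < \<mu>" "\<mu> < \<beta> * \<delta>"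
    and stable: "(\<delta> + \<mu>) * rho G < 1 + \<beta>" "(\<delta> - \<mu>) * rho G < 1 - \<beta>"
begin

abbreviation "Mp \<equiv> M_plus G \<beta> \<delta> \<mu>"
abbreviation "Mm \<equiv> M_minus G \<beta> \<delta> \<mu>"
abbreviation "Q \<equiv> Q_mat G \<beta> \<delta> \<mu>"
abbreviation "v \<equiv> v_vec G \<beta> \<delta> \<mu>"
abbreviation "D \<equiv> M_diff G \<beta> \<delta> \<mu>"

lemma G: "G \<in> carrier_mat n n" "0\<^sub>m n n \<le> G" "G\<^sup>T = G"
proof -
  show c: "G \<in> carrier_mat n n" using adj by (simp add: adjacency_matrix_def)
  have "G $$ (i, j) \<in> {0, 1}" if "i < n" "j < n" for i j
    using adj that by (simp add: adjacency_matrix_def)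
  then have "0 \<le> G $$ (i, j)" if "i < n" "j < n" for i j
    using that by fastforce
  then show "0\<^sub>m n n \<le> G" using c by (auto simp: less_eq_mat_def)
  show "G\<^sup>T = G" by (rule eq_matI) (use adj in \<open>auto simp: adjacency_matrix_def\<close>)
qed

lemma dim_G [simp]: "dim_row G = n"
  using G(1) by simp

lemma \<mu>_less_\<delta>: "\<mu> < \<delta>"
proof -
  have "\<beta> * \<delta> < 1 * \<delta>" by (rule mult_strict_right_mono) (use \<beta> \<delta> in auto)
  then show ?thesis using \<mu> by simp
qed

lemma M_carrier: "Mp \<in> carrier_mat n n" "Mm \<in> carrier_mat n n"
  unfolding M_plus_def M_minus_def dim_G
  by (rule minv_resolvent[OF n G]; use \<beta> \<delta> \<mu> \<mu>_less_\<delta> stable G(1) in auto)+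

lemma M_nonneg: "0\<^sub>m n n \<le> Mp" "0\<^sub>m n n \<le> Mm"
  unfolding M_plus_def M_minus_def dim_G
  by (rule resolvent_nonneg[OF n G]; use \<beta> \<delta> \<mu> \<mu>_less_\<delta> stable in auto)+

lemma M_symmetric: "Mp\<^sup>T = Mp" "Mm\<^sup>T = Mm"
  unfolding M_plus_def M_minus_def dim_G
  by (rule resolvent_symmetric[OF n G]; use \<beta> \<delta> \<mu> \<mu>_less_\<delta> stable in auto)+

lemma M_plus_le_M_minus: "Mp \<le> Mm"
  unfolding M_plus_def M_minus_def dim_G
proof (rule resolvent_mono[OF n G])
  show "(\<delta> + \<mu>) / (1 + \<beta>) \<le> (\<delta> - \<mu>) / (1 - \<beta>)"
  proof -
    have "(\<delta> + \<mu>) * (1 - \<beta>) \<le> (\<delta> - \<mu>) * (1 + \<beta>)"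
      using \<mu>(2) by (simp add: algebra_simps)
    then show ?thesis using \<beta> by (simp add: frac_le_eq divide_le_0_iff field_simps)
  qed
qed (use \<beta> \<delta> \<mu> \<mu>_less_\<delta> stable in auto)

lemma M_diff_carrier: "D \<in> carrier_mat n n"
  unfolding M_diff_def by (rule minus_carrier_mat[OF M_carrier(1)])

lemma Q_carrier: "Q \<in> carrier_mat n n"
  unfolding Q_mat_def
  by (intro add_carrier_mat smult_carrier_mat pow_carrier_mat M_carrier)

lemma v_carrier: "v pB \<in> carrier_vec n"
proof -
  have "R_mat G \<beta> \<delta> \<mu> \<in> carrier_mat n n"
    unfolding R_mat_def
    by (rule minus_carrier_mat[OF smult_carrier_mat[OF pow_carrier_mat[OF M_carrier(1)]]])
  then have "dim_vec (R_mat G \<beta> \<delta> \<mu> *\<^sub>v pB) = n"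
    unfolding dim_mult_mat_vec by (rule carrier_matD(1))
  then have "dim_vec (v pB) = n"
    unfolding v_vec_def index_smult_vec(2) .
  then show ?thesis by (rule carrier_vecI)
qed

lemmas dims [simp] = carrier_matD[OF M_carrier(1)] carrier_matD[OF M_carrier(2)]
  carrier_matD[OF M_diff_carrier] carrier_matD[OF Q_carrier] carrier_vecD[OF v_carrier]

lemma M_diff_nonneg: "0\<^sub>m n n \<le> D"
  using M_plus_le_M_minus by (simp add: M_diff_def less_eq_mat_def)

lemma Q_nonneg: "0\<^sub>m n n \<le> Q"
proof -
  have sq: "0 \<le> (A ^\<^sub>m 2) $$ (i, j)"
    if A: "A \<in> carrier_mat n n" "0\<^sub>m n n \<le> A" and ij: "i < n" "j < n" for A :: "real mat" and i j
  proof -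
    have "A ^\<^sub>m 2 = A * A" using A(1) by (simp add: numeral_2_eq_2)
    then show ?thesis
      using mult_mat_nonneg[OF A(1) A(1) A(2) A(2)] A(1) ij by (auto simp: less_eq_mat_def)
  qed
  have "0 \<le> Q $$ (i, j)" if ij: "i < n" "j < n" for i j
    using sq[OF M_carrier(1) M_nonneg(1) ij] sq[OF M_carrier(2) M_nonneg(2) ij] \<beta> ij
    by (simp add: Q_mat_def)
  then show ?thesis by (simp add: less_eq_mat_def)
qed

lemma Q_symmetric: "Q\<^sup>T = Q"
proof -
  have sq: "(A ^\<^sub>m 2) $$ (j, i) = (A ^\<^sub>m 2) $$ (i, j)"
    if A: "A \<in> carrier_mat n n" "A\<^sup>T = A" and ij: "i < n" "j < n" for A :: "real mat" and i j
  proof -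
    have "A ^\<^sub>m 2 = A * A" using A(1) by (simp add: numeral_2_eq_2)
    moreover have "(A * A)\<^sup>T = A * A" using transpose_mult[OF A(1) A(1)] unfolding A(2) .
    moreover have "(A * A)\<^sup>T $$ (i, j) = (A * A) $$ (j, i)"
      by (rule index_transpose_mat(1)) (use A(1) ij in auto)
    ultimately show ?thesis by simp
  qed
  show ?thesis
  proof (rule eq_matI)
    fix i j assume "i < dim_row Q" "j < dim_col Q"
    then have ij: "i < n" "j < n" by simp_all
    then show "Q\<^sup>T $$ (i, j) = Q $$ (i, j)"
      using sq[OF M_carrier(1) M_symmetric(1) ij] sq[OF M_carrier(2) M_symmetric(2) ij]
      by (simp add: Q_mat_def)
  qed simp_all
qed

lemma welfare_diff:
  assumes p: "p \<in> carrier_vec n" and q: "q \<in> carrier_vec n"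
  shows "welfare G \<beta> \<delta> \<mu> pB p - welfare G \<beta> \<delta> \<mu> pB q = (p - q) \<bullet> (Q *\<^sub>v (p + q) - v pB) / 4"
proof -
  have Qc: "Q *\<^sub>v (p + q) \<in> carrier_vec n" using p q by (simp add: mult_mat_vec_carrier[OF Q_carrier])
  have "(p - q) \<bullet> (Q *\<^sub>v (p + q) - v pB) = (p - q) \<bullet> (Q *\<^sub>v (p + q)) - (p \<bullet> v pB - q \<bullet> v pB)"
    using scalar_prod_minus_distrib[of "p - q" n, OF _ Qc v_carrier]
      minus_scalar_prod_distrib[OF p q v_carrier] p q by simp
  moreover have "p \<bullet> v pB = v pB \<bullet> p" "q \<bullet> v pB = v pB \<bullet> q"
    using p q by (auto intro: comm_scalar_prod[OF _ v_carrier])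
  ultimately show ?thesis
    using quadratic_form_diff[OF Q_carrier Q_symmetric p q]
    by (simp add: welfare_def field_simps)
qed

lemma welfare_mono:
  assumes p: "p \<in> carrier_vec n" and q: "q \<in> carrier_vec n" and qp: "q \<le> p"
    and "C1 G \<beta> \<delta> \<mu> pB p q"
  shows "welfare G \<beta> \<delta> \<mu> pB q \<le> welfare G \<beta> \<delta> \<mu> pB p"
proof -
  have "0 \<le> (p - q) \<bullet> (Q *\<^sub>v (p + q) - v pB)"
    unfolding scalar_prod_def
    using assms
    by (intro sum_nonneg mult_nonneg_nonneg)
      (auto simp: C1_def less_eq_vec_def simp del: index_mult_mat_vec)
  then show ?thesis using welfare_diff[OF p q, of pB] by simp
qed

lemma welfare_strict_antimono:
  assumes p: "p \<in> carrier_vec n" and q: "q \<in> carrier_vec n" and qp: "q \<le> p"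
    and C2: "C2 G \<beta> \<delta> \<mu> pB p q" and ne: "p \<noteq> q"
  shows "welfare G \<beta> \<delta> \<mu> pB p < welfare G \<beta> \<delta> \<mu> pB q"
proof -
  let ?w = "Q *\<^sub>v (p + q) - v pB"
  have pq: "q $ i \<le> p $ i" if "i < n" for i using qp p q that by (auto simp: less_eq_vec_def)
  have w: "?w $ i < 0" if "i < n" for i
    using that C2
    by (auto simp: C2_def vec_lt_def simp del: index_mult_mat_vec)
  obtain i where i: "i < n" "p $ i \<noteq> q $ i" using ne p q by (metis eq_vecI carrier_vecD)
  have "(\<Sum>i<n. (p $ i - q $ i) * ?w $ i) < (\<Sum>i<n. 0)"
  proof (rule sum_strict_mono_ex1)
    show "\<forall>i\<in>{..<n}. (p $ i - q $ i) * ?w $ i \<le> 0"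
      using pq w by (intro ballI mult_nonneg_nonpos) (auto intro: less_imp_le simp del: index_minus_vec)
    show "\<exists>i\<in>{..<n}. (p $ i - q $ i) * ?w $ i < 0"
      using pq[OF i(1)] w[OF i(1)] i by (intro bexI[of _ i] mult_pos_neg) auto
  qed simp
  also have "(\<Sum>i<n. (p $ i - q $ i) * ?w $ i) = (p - q) \<bullet> ?w"
    using p q
    by (auto simp: scalar_prod_def atLeast0LessThan intro!: sum.cong)
  finally show ?thesis using welfare_diff[OF p q, of pB] by simp
qed

text \<open>This extends (C1) and (C2) from a pair of extreme policies to all policies in between.\<close>

lemma Q_sum_mono:
  assumes "p \<in> carrier_vec n" "p' \<in> carrier_vec n" "q \<in> carrier_vec n" "q' \<in> carrier_vec n"
    and "p \<le> p'" "q \<le> q'"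
  shows "Q *\<^sub>v (p + q) \<le> Q *\<^sub>v (p' + q')"
  by (rule mult_mat_vec_mono[OF Q_carrier Q_nonneg])
    (use assms in \<open>auto simp: less_eq_vec_def intro!: add_mono\<close>)

text \<open>The policy enters the effort through \<open>M_plus - M_minus\<close>, which is entrywise nonpositive.\<close>

lemma aggregate_B_antimono:
  assumes p: "p \<in> carrier_vec n" and q: "q \<in> carrier_vec n" and pB: "pB \<in> carrier_vec n"
    and qp: "q \<le> p"
  shows "aggregate_B G \<beta> \<delta> \<mu> pB p \<le> aggregate_B G \<beta> \<delta> \<mu> pB q"
proof -
  have D: "D *\<^sub>v q \<le> D *\<^sub>v p"
    by (rule mult_mat_vec_mono[OF M_diff_carrier M_diff_nonneg q p qp])
  have neg: "((Mp - Mm) *\<^sub>v x) $ i = - (D *\<^sub>v x) $ i" if "i < n" "x \<in> carrier_vec n" for i x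
  proof -
    have "(Mp - Mm) *\<^sub>v x = Mp *\<^sub>v x - Mm *\<^sub>v x" "D *\<^sub>v x = Mm *\<^sub>v x - Mp *\<^sub>v x"
      unfolding M_diff_def
      by (simp_all only: minus_mult_distrib_mat_vec[OF M_carrier that(2)]
          minus_mult_distrib_mat_vec[OF M_carrier(2,1) that(2)])
    then show ?thesis using that
      by (simp del: index_mult_mat_vec)
  qed
  have "((Mp - Mm) *\<^sub>v p) $ i \<le> ((Mp - Mm) *\<^sub>v q) $ i" if "i < n" for i
    using that D neg[OF that p] neg[OF that q]
    by (simp add: less_eq_vec_def del: index_mult_mat_vec)
  then show ?thesis
    unfolding aggregate_B_def effort_B_def dim_G
    by (intro sum_mono) (simp del: index_mult_mat_vec)
qed

end

theorem theorem4:
  fixes n :: nat and G :: "real mat" and \<beta> \<delta> \<mu> :: real and pA0 pB0 :: "real vec"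
  assumes "n \<ge> 1"
    and "adjacency_matrix n G"
    and "0 < \<beta>" and "\<beta> < 1" and "\<delta> > 0" and "\<mu> > 0"
    and "pA0 \<in> carrier_vec n" and "0\<^sub>v n \<le> pA0"
    and "pB0 \<in> carrier_vec n" and "0\<^sub>v n \<le> pB0"
    and "max (\<bar>\<delta> + \<mu>\<bar> / (1 + \<beta>)) (\<bar>\<delta> - \<mu>\<bar> / (1 - \<beta>)) * rho G < 1"
    and "\<mu> < \<beta> * \<delta>"
    and "vec_lt (0\<^sub>v n) (effort_A G \<beta> \<delta> \<mu> pB0 pA0)"
    and "vec_lt (0\<^sub>v n) (effort_B G \<beta> \<delta> \<mu> pB0 pA0)"
  shows
    "(\<forall>p1 \<in> carrier_vec n. \<forall>p2 \<in> carrier_vec n.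
        pA0 \<le> p2 \<longrightarrow> p2 \<le> p1 \<longrightarrow> p1 \<le> p_lim G \<beta> \<delta> \<mu> pB0 \<longrightarrow>
          (C1 G \<beta> \<delta> \<mu> pB0 p1 p2 \<longrightarrow> welfare G \<beta> \<delta> \<mu> pB0 p1 \<ge> welfare G \<beta> \<delta> \<mu> pB0 p2) \<and>
          (C2 G \<beta> \<delta> \<mu> pB0 p1 p2 \<longrightarrow> p1 \<noteq> p2 \<longrightarrow>
             welfare G \<beta> \<delta> \<mu> pB0 p1 < welfare G \<beta> \<delta> \<mu> pB0 p2)) \<and>
     (\<forall>\<tau>B \<ge> 0. \<forall>pmax \<in> carrier_vec n.
        pA0 \<le> pmax \<longrightarrow> b_diff G \<beta> \<delta> \<mu> \<bullet> pmax \<ge> k0 G \<beta> \<delta> \<mu> pB0 \<tau>B \<longrightarrow>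
          (pmax \<le> p_lim G \<beta> \<delta> \<mu> pB0 \<longrightarrow> C1 G \<beta> \<delta> \<mu> pB0 pmax pA0 \<longrightarrow>
             optimal G \<beta> \<delta> \<mu> pA0 pB0 \<tau>B pmax pmax \<and>
             (\<forall>p \<in> feasible G \<beta> \<delta> \<mu> pA0 pB0 \<tau>B pmax.
                aggregate_B G \<beta> \<delta> \<mu> pB0 pmax \<le> aggregate_B G \<beta> \<delta> \<mu> pB0 p)) \<and>
          (C2 G \<beta> \<delta> \<mu> pB0 pmax pA0 \<longrightarrow> b_diff G \<beta> \<delta> \<mu> \<bullet> pA0 \<ge> k0 G \<beta> \<delta> \<mu> pB0 \<tau>B \<longrightarrow>
             optimal G \<beta> \<delta> \<mu> pA0 pB0 \<tau>B pmax pA0 \<and>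
             (\<forall>p \<in> feasible G \<beta> \<delta> \<mu> pA0 pB0 \<tau>B pmax.
                aggregate_B G \<beta> \<delta> \<mu> pB0 p \<le> aggregate_B G \<beta> \<delta> \<mu> pB0 pA0)))"
proof -
  have n: "n > 0" and G: "G \<in> carrier_mat n n"
    using assms(1,2) by (auto simp: adjacency_matrix_def)
  let ?m = "max (\<bar>\<delta> + \<mu>\<bar> / (1 + \<beta>)) (\<bar>\<delta> - \<mu>\<bar> / (1 - \<beta>))"
  have stable: "b * rho G < a" if "0 < a" "\<bar>b\<bar> / a \<le> ?m" for a b
  proof -
    have "b / a \<le> \<bar>b\<bar> / a" using that(1) by (simp add: divide_right_mono)
    then have "b / a * rho G \<le> ?m * rho G"
      using that(2) by (intro mult_right_mono rho_nonneg[OF G n]) linarith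
    also note \<open>?m * rho G < 1\<close>
    finally show ?thesis using that(1) by (simp add: field_simps)
  qed
  interpret coupled_markets n G \<beta> \<delta> \<mu>
    by unfold_locales
      (use assms n stable[of "1 + \<beta>" "\<delta> + \<mu>"] stable[of "1 - \<beta>" "\<delta> - \<mu>"] in auto)
  note pA0 = \<open>pA0 \<in> carrier_vec n\<close> and pB0 = \<open>pB0 \<in> carrier_vec n\<close>
  have max_opt: "optimal G \<beta> \<delta> \<mu> pA0 pB0 \<tau> pmax pmax"
    if pmax: "pmax \<in> carrier_vec n" "pA0 \<le> pmax" "k0 G \<beta> \<delta> \<mu> pB0 \<tau> \<le> b_diff G \<beta> \<delta> \<mu> \<bullet> pmax"
      and c: "C1 G \<beta> \<delta> \<mu> pB0 pmax pA0" for \<tau> pmax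
    unfolding optimal_def
  proof (intro conjI ballI)
    show "pmax \<in> feasible G \<beta> \<delta> \<mu> pA0 pB0 \<tau> pmax" using pmax by (simp add: feasible_def)
    fix q assume "q \<in> feasible G \<beta> \<delta> \<mu> pA0 pB0 \<tau> pmax"
    then have q: "q \<in> carrier_vec n" "pA0 \<le> q" "q \<le> pmax" by (auto simp: feasible_def)
    \<comment> \<open>Raising \<open>pA0\<close> to \<open>q\<close> only increases the left-hand side of (C1).\<close>
    have "C1 G \<beta> \<delta> \<mu> pB0 pmax q"
      using c Q_sum_mono[OF pmax(1) pmax(1) pA0 q(1) order_refl q(2)]
      unfolding C1_def by (rule order_trans)
    then show "welfare G \<beta> \<delta> \<mu> pB0 q \<le> welfare G \<beta> \<delta> \<mu> pB0 pmax"
      by (rule welfare_mono[OF pmax(1) q(1,3)])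
  qed
  have init_opt: "optimal G \<beta> \<delta> \<mu> pA0 pB0 \<tau> pmax pA0"
    if pmax: "pmax \<in> carrier_vec n" "pA0 \<le> pmax"
      and t: "k0 G \<beta> \<delta> \<mu> pB0 \<tau> \<le> b_diff G \<beta> \<delta> \<mu> \<bullet> pA0"
      and c: "C2 G \<beta> \<delta> \<mu> pB0 pmax pA0" for \<tau> pmax
    unfolding optimal_def
  proof (intro conjI ballI)
    show "pA0 \<in> feasible G \<beta> \<delta> \<mu> pA0 pB0 \<tau> pmax" using pA0 pmax t by (simp add: feasible_def)
    fix q assume "q \<in> feasible G \<beta> \<delta> \<mu> pA0 pB0 \<tau> pmax"
    then have q: "q \<in> carrier_vec n" "pA0 \<le> q" "q \<le> pmax" by (auto simp: feasible_def)
    \<comment> \<open>Lowering \<open>pmax\<close> to \<open>q\<close> only decreases the left-hand side of (C2).\<close>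
    have "C2 G \<beta> \<delta> \<mu> pB0 q pA0"
      using c Q_sum_mono[OF q(1) pmax(1) pA0 pA0 q(3) order_refl]
      unfolding C2_def vec_lt_def less_eq_vec_def by (metis order_le_less_trans)
    then show "welfare G \<beta> \<delta> \<mu> pB0 q \<le> welfare G \<beta> \<delta> \<mu> pB0 pA0"
      using welfare_strict_antimono[OF q(1) pA0 q(2)] by (cases "q = pA0") (auto intro: less_imp_le)
  qed
  have agg: "aggregate_B G \<beta> \<delta> \<mu> pB0 pmax \<le> aggregate_B G \<beta> \<delta> \<mu> pB0 p"
    "aggregate_B G \<beta> \<delta> \<mu> pB0 p \<le> aggregate_B G \<beta> \<delta> \<mu> pB0 pA0"
    if "pmax \<in> carrier_vec n" "p \<in> feasible G \<beta> \<delta> \<mu> pA0 pB0 \<tau> pmax" for p \<tau> pmax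
    using that pA0 pB0 by (auto simp: feasible_def intro!: aggregate_B_antimono)
  show ?thesis
  proof (intro conjI ballI allI impI)
    fix p1 p2 :: "real vec"
    assume "p1 \<in> carrier_vec n" "p2 \<in> carrier_vec n" "p2 \<le> p1"
    note p = this
    show "welfare G \<beta> \<delta> \<mu> pB0 p2 \<le> welfare G \<beta> \<delta> \<mu> pB0 p1" if "C1 G \<beta> \<delta> \<mu> pB0 p1 p2"
      by (rule welfare_mono[OF p that])
    show "welfare G \<beta> \<delta> \<mu> pB0 p1 < welfare G \<beta> \<delta> \<mu> pB0 p2"
      if "C2 G \<beta> \<delta> \<mu> pB0 p1 p2" "p1 \<noteq> p2"
      by (rule welfare_strict_antimono[OF p that])
  qed (auto intro: max_opt init_opt agg)
qed

end
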